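(* Let $G$ be a finite abstract simplicial complex, let $G_1$ be its Barycentric refinement graph, let $G'$ be its connection graph, and let $A'$ be the adjacency matrix of $G'$. Then for every simplex $x$ of $G$, $$(1+A')^{-1}_{xx} = 1-\chi(S(x)),$$ where $S(x)$ is the unit sphere of the vertex $x$ in the graph $G_1$.
   Context: A finite abstract simplicial complex $G$ is a finite set of non-empty finite sets (simplices) closed under taking non-empty subsets; $\dim(x)=|x|-1$. The Barycentric refinement graph $G_1$ has the simplices of $G$ as vertices, two distinct simplices being adjacent if one is a subset of the other. The connection graph $G'$ has the same vertex set, two distinct simplices being adjacent if they have non-empty intersection. The unit sphere $S(x)$ of a vertex $x$ in a graph is the subgraph induced on the neighbors of $x$. The Euler characteristic of a finite simple graph is $\chi=\sum_{k\ge 0}(-1)^k v_k$, where $v_k$ is the number of complete subgraphs with $k+1$ vertices; the empty graph has $\chi=0$. The matrix $1+A'$ (identity plus adjacency matrix, indexed by the simplices of $G$) is invertible over $\mathbb{Z}$, by the known unimodularity theorem $\det(1+A')=\prod_{x\in G}(-1)^{\dim(x)}$. *)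

theory Defs
  imports "Jordan_Normal_Form.Matrix" "Graph_Theory.Kuratowski"
begin

text \<open>Finite simple graphs are the symmetric loop-free digraphs without parallel arcs of
  Graph_Theory: an edge is a pair of opposite arcs.\<close>

definition simplicial_complex :: "'a set set \<Rightarrow> bool" where
  "simplicial_complex G \<longleftrightarrow>
     finite G \<and>
     (\<forall>x\<in>G. finite x \<and> x \<noteq> {}) \<and>
     (\<forall>x\<in>G. \<forall>y. y \<subseteq> x \<and> y \<noteq> {} \<longrightarrow> y \<in> G)"

definition barycentric_graph :: "'a set set \<Rightarrow> ('a set, 'a set \<times> 'a set) pre_digraph" where
  "barycentric_graph G = with_proj
     \<lparr> pverts = G,
       parcs = {(x, y). x \<in> G \<and> y \<in> G \<and> x \<noteq> y \<and> (x \<subseteq> y \<or> y \<subseteq> x)} \<rparr>"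

definition connection_graph :: "'a set set \<Rightarrow> ('a set, 'a set \<times> 'a set) pre_digraph" where
  "connection_graph G = with_proj
     \<lparr> pverts = G,
       parcs = {(x, y). x \<in> G \<and> y \<in> G \<and> x \<noteq> y \<and> x \<inter> y \<noteq> {}} \<rparr>"

definition unit_sphere :: "('v, 'e) pre_digraph \<Rightarrow> 'v \<Rightarrow> ('v, 'e) pre_digraph" where
  "unit_sphere \<Gamma> x = \<Gamma> \<restriction> {y. x \<rightarrow>\<^bsub>\<Gamma>\<^esub> y}"

definition num_complete_subgraphs :: "('v, 'e) pre_digraph \<Rightarrow> nat \<Rightarrow> nat" where
  "num_complete_subgraphs \<Gamma> n = card {H. subgraph H \<Gamma> \<and> complete_digraph n H}"

text \<open>The sum stops at the number of vertices, since no larger complete subgraph exists.\<close>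

definition euler_characteristic :: "('v, 'e) pre_digraph \<Rightarrow> int" where
  "euler_characteristic \<Gamma> =
     (\<Sum>k<card (verts \<Gamma>). (-1) ^ k * int (num_complete_subgraphs \<Gamma> (k + 1)))"

text \<open>Matrices are indexed by numbers, so the vertices are given by an enumeration \<open>vs\<close>.\<close>

definition adjacency_matrix :: "('v, 'e) pre_digraph \<Rightarrow> 'v list \<Rightarrow> int mat" where
  "adjacency_matrix \<Gamma> vs =
     mat (length vs) (length vs) (\<lambda>(i, j). if vs ! i \<rightarrow>\<^bsub>\<Gamma>\<^esub> vs ! j then 1 else 0)"

end

(* Write s(w) = (-1)^(|w|+1). A nonempty finite simplex has Euler characteristic 1, so the
   connection matrix 1 + A' is Z^T D Z with Z the inclusion matrix of G and D = diag(s).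
   Moebius inversion gives the inverse explicitly: its (x,y) entry is s(x) s(y) times the sum
   of s over the simplices containing both x and y, hence the diagonal entry at x is the sum
   of s over the star of x.
   On the other side 1 - chi(S(x)) is the sum of (-1)^|c| over all chains c, including the
   empty one, of simplices strictly comparable with x. It factors into the part below and the
   part above x; sorting chains by their maximum turns each factor into sums over open
   Boolean intervals, and the product is again the sum of s over the star of x. *)

theory Submission
  imports Defs
begin

section \<open>Alternating sums over Boolean intervals\<close>

text \<open>Toggling a fixed element of \<open>b - a\<close> is a sign-reversing involution of the
  interval, so for a different from b the sum equals its own negative.\<close>

lemma sum_alternating_interval:
  assumes "finite b" and "a \<subseteq> b"
  shows "(\<Sum>y | a \<subseteq> y \<and> y \<subseteq> b. (-1) ^ card y) = (if a = b then (-1) ^ card a else (0::int))"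
proof (cases "a = b")
  case True
  then have "{y. a \<subseteq> y \<and> y \<subseteq> b} = {b}" by auto
  with True show ?thesis by simp
next
  case False
  with assms obtain v where v: "v \<in> b" "v \<notin> a" by auto
  define t where "t y = (if v \<in> y then y - {v} else insert v y)" for y
  have "(\<Sum>y | a \<subseteq> y \<and> y \<subseteq> b. (-1) ^ card y) = (\<Sum>y | a \<subseteq> y \<and> y \<subseteq> b. - ((-1) ^ card y :: int))"
  proof (rule sum.reindex_bij_witness[of _ t t])
    fix y assume y: "y \<in> {y. a \<subseteq> y \<and> y \<subseteq> b}"
    then have "finite y" using assms finite_subset by blast
    show "- ((-1) ^ card (t y)) = ((-1) ^ card y :: int)"
    proof (cases "v \<in> y")
      case True
      then have "card y = Suc (card (t y))"
        using card_Suc_Diff1[OF \<open>finite y\<close>] by (simp add: t_def)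
      then show ?thesis by simp
    qed (simp add: t_def \<open>finite y\<close>)
  qed (use v in \<open>auto simp: t_def\<close>)
  then show ?thesis using False by (simp add: sum_negf)
qed

text \<open>This is the Euler characteristic of a full simplex. The empty case is kept because the
  set \<open>w - x\<close> used later may be empty.\<close>

lemma sum_alternating_nonempty_subsets:
  assumes "finite b"
  shows "(\<Sum>y | y \<noteq> {} \<and> y \<subseteq> b. (-1) ^ Suc (card y)) = (if b = {} then 0 else (1::int))"
proof -
  have fin: "finite {y. y \<subseteq> b}" using assms by simp
  have eq: "{y. y \<noteq> {} \<and> y \<subseteq> b} = {y. y \<subseteq> b} - {{}}" by auto
  show ?thesis
    using sum_alternating_interval[OF assms, of "{}"]
    unfolding eq by (simp add: sum_diff1 fin sum_negf split: if_splits)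
qed

section \<open>Alternating sums over chains\<close>

text \<open>The empty chain belongs to \<open>chains A\<close>, so for finite A this is minus the
  reduced Euler characteristic of the order complex of A.\<close>

definition chain_sum :: "'a set set \<Rightarrow> int" where
  "chain_sum A = (\<Sum>c\<in>chains A. (-1) ^ card c)"

lemma finite_chains: "finite A \<Longrightarrow> finite (chains A)"
  by (rule finite_subset[of _ "Pow A"]) (auto simp: chains_def)

text \<open>The union of such a chain is its maximum, which gives a closed formula for the bijection
  in \<open>chain_sum_by_maximum\<close>.\<close>

lemma Union_mem_chain:
  assumes "finite c" and "c \<noteq> {}" and "chain\<^sub>\<subseteq> c"
  shows "\<Union>c \<in> c"
  using assms by (intro Union_in_chain) (auto simp: subset_chain_def chain_subset_def)

text \<open>The 1 is the empty chain. Deleting the maximum m of any other chain leaves a possibly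
  empty chain strictly below m and flips the sign.\<close>

lemma chain_sum_by_maximum:
  assumes fin: "finite A"
  shows "chain_sum A = 1 - (\<Sum>m\<in>A. chain_sum {y\<in>A. y \<subset> m})"
proof -
  let ?C = "\<lambda>m. chains {y\<in>A. y \<subset> m}"
  have fin_mem: "finite c" if "c \<in> chains A" for c
    using that fin finite_subset by (auto simp: chains_def)
  have "chain_sum A = 1 + (\<Sum>c\<in>chains A - {{}}. (-1) ^ card c)"
    unfolding chain_sum_def
    by (subst sum.remove[of _ "{}"]) (auto simp: finite_chains fin chains_def chain_subset_def)
  also have "(\<Sum>c\<in>chains A - {{}}. (-1) ^ card c) = (\<Sum>(m, d)\<in>Sigma A ?C. - ((-1::int) ^ card d))"
  proof (rule sum.reindex_bij_witness[of _ "\<lambda>(m, d). insert m d" "\<lambda>c. (\<Union>c, c - {\<Union>c})"])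
    fix c assume c: "c \<in> chains A - {{}}"
    then have "finite c" using fin_mem by auto
    then have m: "\<Union>c \<in> c" using c by (intro Union_mem_chain) (auto simp: chains_def)
    show "(case (\<Union>c, c - {\<Union>c}) of (m, d) \<Rightarrow> insert m d) = c" using m by auto
    have "card c = Suc (card (c - {\<Union>c}))" by (metis card_Suc_Diff1 \<open>finite c\<close> m)
    then show "(case (\<Union>c, c - {\<Union>c}) of (m, d) \<Rightarrow> - ((-1) ^ card d)) = ((-1) ^ card c :: int)"
      by simp
    show "(\<Union>c, c - {\<Union>c}) \<in> Sigma A ?C"
      using c m by (auto simp: chains_def chain_subset_def)
  next
    fix p assume "p \<in> Sigma A ?C"
    then obtain m d where p: "p = (m, d)" "m \<in> A" "d \<in> ?C m" by auto
    have "\<Union>(insert m d) = m" "m \<notin> d" using p by (auto simp: chains_def)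
    then show "(\<Union>(case p of (m, d) \<Rightarrow> insert m d),
        (case p of (m, d) \<Rightarrow> insert m d) - {\<Union>(case p of (m, d) \<Rightarrow> insert m d)}) = p"
      using p by auto
    show "(case p of (m, d) \<Rightarrow> insert m d) \<in> chains A - {{}}"
      using p by (auto simp: chains_def chain_subset_def)
  qed
  also have "\<dots> = (\<Sum>m\<in>A. \<Sum>d\<in>?C m. - ((-1) ^ card d))"
    by (rule sum.Sigma[symmetric]) (use fin in \<open>auto intro: finite_chains\<close>)
  finally show ?thesis by (simp add: chain_sum_def sum_negf)
qed

text \<open>By Hall's theorem this is minus the Moebius function of the Boolean lattice. The
  induction works because the part of the interval below a member m is the open interval from a to
  m.\<close>

lemma chain_sum_open_interval:
  assumes "finite b" and "a \<subset> b"
  shows "chain_sum {y. a \<subset> y \<and> y \<subset> b} = - ((-1) ^ card a * (-1) ^ card b)"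
  using assms
proof (induction b rule: finite_psubset_induct)
  case (psubset b)
  let ?I = "{y. a \<subset> y \<and> y \<subset> b}"
  have finI: "finite ?I" using psubset.hyps by (rule_tac finite_subset[of _ "Pow b"]) auto
  have "chain_sum ?I = 1 - (\<Sum>m\<in>?I. chain_sum {y\<in>?I. y \<subset> m})"
    by (rule chain_sum_by_maximum[OF finI])
  also have "(\<Sum>m\<in>?I. chain_sum {y\<in>?I. y \<subset> m}) = (\<Sum>m\<in>?I. - ((-1) ^ card a * (-1) ^ card m))"
  proof (rule sum.cong[OF refl])
    fix m assume m: "m \<in> ?I"
    then have "{y\<in>?I. y \<subset> m} = {y. a \<subset> y \<and> y \<subset> m}" by auto
    then show "chain_sum {y\<in>?I. y \<subset> m} = - ((-1) ^ card a * (-1) ^ card m)"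
      using psubset.IH[of m] m by simp
  qed
  also have "\<dots> = - ((-1) ^ card a * (\<Sum>m\<in>?I. (-1) ^ card m))"
    by (simp add: sum_negf sum_distrib_left)
  \<comment> \<open>The alternating sum over the closed interval vanishes; splitting off its two
    endpoints leaves this value.\<close>
  also have "(\<Sum>m\<in>?I. (-1) ^ card m) = - ((-1) ^ card a) - ((-1) ^ card b :: int)"
  proof -
    have eq: "{y. a \<subseteq> y \<and> y \<subseteq> b} = insert a (insert b ?I)" using psubset.prems by auto
    have "a \<notin> insert b ?I" "b \<notin> ?I" using psubset.prems by auto
    then show ?thesis
      using sum_alternating_interval[OF psubset.hyps psubset_imp_subset[OF psubset.prems]]
      unfolding eq by (simp add: finI split: if_splits)
  qed
  finally show ?case by (simp add: algebra_simps flip: power_add)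
qed

text \<open>A chain of the union is cut uniquely into its traces on A and B, and any two chains can
  be stacked because B lies above A. Strictness makes A and B disjoint, so cardinalities add and
  signs multiply.\<close>

lemma chain_sum_union:
  assumes "finite A" and "finite B" and "\<And>u v. u \<in> A \<Longrightarrow> v \<in> B \<Longrightarrow> u \<subset> v"
  shows "chain_sum (A \<union> B) = chain_sum A * chain_sum B"
proof -
  have disj: "A \<inter> B = {}" using assms(3) by blast
  have "chain_sum A * chain_sum B = (\<Sum>(c, d)\<in>chains A \<times> chains B. (-1) ^ card c * (-1) ^ card d)"
    by (simp add: chain_sum_def sum_product sum.cartesian_product)
  also have "\<dots> = chain_sum (A \<union> B)"
    unfolding chain_sum_def
  proof (rule sum.reindex_bij_witness[of _ "\<lambda>e. (e \<inter> A, e \<inter> B)" "\<lambda>(c, d). c \<union> d"])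
    fix p assume "p \<in> chains A \<times> chains B"
    then obtain c d where p: "p = (c, d)" "c \<in> chains A" "d \<in> chains B" by auto
    then have cd: "c \<subseteq> A" "d \<subseteq> B" by (auto simp: chains_def)
    show "((case p of (c, d) \<Rightarrow> c \<union> d) \<inter> A, (case p of (c, d) \<Rightarrow> c \<union> d) \<inter> B) = p"
      using p cd disj by auto
    have "u \<subseteq> v \<or> v \<subseteq> u" if "u \<in> c \<union> d" "v \<in> c \<union> d" for u v
    proof -
      have "u \<subseteq> v \<or> v \<subseteq> u" if "u \<in> c" "v \<in> c"
        using p(2) that by (simp add: chains_def chain_subset_def)
      moreover have "u \<subseteq> v \<or> v \<subseteq> u" if "u \<in> d" "v \<in> d"
        using p(3) that by (simp add: chains_def chain_subset_def)
      moreover have "u \<subseteq> v" if "u \<in> c" "v \<in> d"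
        using assms(3) cd that by blast
      moreover have "v \<subseteq> u" if "v \<in> c" "u \<in> d"
        using assms(3) cd that by blast
      ultimately show ?thesis using that by blast
    qed
    then have "chain\<^sub>\<subseteq> (c \<union> d)" unfolding chain_subset_def by blast
    then show "(case p of (c, d) \<Rightarrow> c \<union> d) \<in> chains (A \<union> B)"
      using p(1) cd by (auto simp: chains_def)
    have "card (c \<union> d) = card c + card d"
      using cd disj assms(1,2) by (intro card_Un_disjoint) (auto intro: finite_subset)
    then show "(-1) ^ card (case p of (c, d) \<Rightarrow> c \<union> d)
        = (case p of (c, d) \<Rightarrow> (-1::int) ^ card c * (-1) ^ card d)"
      using p by (simp add: power_add)
  qed (auto simp: chains_def chain_subset_def)
  finally show ?thesis ..
qed

section \<open>The Euler characteristic of a unit sphere\<close>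

lemma arcs_ends_barycentric_graph:
  "arcs_ends (barycentric_graph A) = {(u, v). u \<in> A \<and> v \<in> A \<and> u \<noteq> v \<and> (u \<subseteq> v \<or> v \<subseteq> u)}"
  by (simp add: barycentric_graph_def)

text \<open>The simplices strictly comparable with x need not form a complex, so the next lemmas
  treat \<open>barycentric_graph A\<close> for an arbitrary finite family A.\<close>

lemma unit_sphere_barycentric_graph:
  assumes "x \<in> G"
  shows "unit_sphere (barycentric_graph G) x = barycentric_graph {y\<in>G. y \<subset> x \<or> x \<subset> y}"
  using assms unfolding unit_sphere_def arcs_ends_barycentric_graph
  by (auto simp: barycentric_graph_def with_proj_def induce_subgraph_def)

lemma graph_barycentric_graph:
  assumes "finite A"
  shows "graph (barycentric_graph A)"
proof -
  have "finite {(u, v). u \<in> A \<and> v \<in> A \<and> u \<noteq> v \<and> (u \<subseteq> v \<or> v \<subseteq> u)}"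
    by (rule finite_subset[of _ "A \<times> A"]) (use assms in auto)
  then show ?thesis
    unfolding barycentric_graph_def
    by unfold_locales (auto simp: assms arc_to_ends_def symmetric_def sym_def)
qed

lemma num_complete_subgraphs_barycentric_graph:
  assumes "finite A"
  shows "num_complete_subgraphs (barycentric_graph A) n = card {c\<in>chains A. card c = n}"
proof -
  have "{H. subgraph H (barycentric_graph A) \<and> complete_digraph n H}
      = barycentric_graph ` {c\<in>chains A. card c = n}" (is "?L = ?R")
  proof
    show "?R \<subseteq> ?L"
    proof
      fix H assume "H \<in> ?R"
      then obtain c where c: "H = barycentric_graph c" "c \<subseteq> A" "chain\<^sub>\<subseteq> c" "card c = n"
        by (auto simp: chains_def)
      then have "graph H" "graph (barycentric_graph A)"
        using graph_barycentric_graph assms finite_subset[of c A] by simp_all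
      then have "wf_digraph H" "wf_digraph (barycentric_graph A)"
        by (simp_all add: graph_def digraph_def fin_digraph_def)
      then show "H \<in> ?L"
        using c \<open>graph H\<close>
        by (auto simp: subgraph_def complete_digraph_def compatible_def
            barycentric_graph_def chain_subset_def)
    qed
    show "?L \<subseteq> ?R"
    proof
      fix H assume "H \<in> ?L"
      then have sub: "verts H \<subseteq> A" "arcs H \<subseteq> arcs_ends (barycentric_graph A)"
        and proj: "tail H = fst" "head H = snd"
        and H: "card (verts H) = n" "arcs_ends H = {(u, v). u \<in> verts H \<and> v \<in> verts H \<and> u \<noteq> v}"
        by (auto simp: subgraph_def complete_digraph_def compatible_def barycentric_graph_def)
      \<comment> \<open>\<open>tail\<close> and \<open>head\<close> are the projections, so an arc
        equals its pair of ends and completeness determines the arc set.\<close>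
      have arcs: "arcs H = {(u, v). u \<in> verts H \<and> v \<in> verts H \<and> u \<noteq> v}"
        using H(2) by (simp add: arcs_ends_conv proj)
      have cmp: "u \<subseteq> v \<or> v \<subseteq> u" if "u \<in> verts H" "v \<in> verts H" for u v
        using that sub(2) unfolding arcs arcs_ends_barycentric_graph by blast
      have "H = barycentric_graph (verts H)"
        using arcs proj cmp
        by (intro pre_digraph.equality) (auto simp: barycentric_graph_def)
      moreover have "verts H \<in> {c\<in>chains A. card c = n}"
        using sub(1) H(1) cmp by (auto simp: chains_def chain_subset_def)
      ultimately show "H \<in> ?R" by blast
    qed
  qed
  moreover have "inj_on barycentric_graph X" for X :: "'a set set set"
    by (rule inj_on_inverseI[of _ verts]) (simp add: barycentric_graph_def)
  ultimately show ?thesis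
    by (simp add: num_complete_subgraphs_def card_image)
qed

text \<open>Cliques are chains. One with k+1 members has sign (-1)^k on the left before the
  subtraction and the opposite sign in \<open>chain_sum\<close>; the empty chain supplies the
  1.\<close>

lemma euler_characteristic_barycentric_graph:
  assumes "finite A"
  shows "1 - euler_characteristic (barycentric_graph A) = chain_sum A"
proof -
  have card_le: "card ` chains A \<subseteq> {..card A}"
    using assms by (auto simp: chains_def intro: card_mono)
  have "chain_sum A = (\<Sum>n\<le>card A. \<Sum>c | c \<in> chains A \<and> card c = n. (-1) ^ card c)"
    unfolding chain_sum_def
    by (rule sum.group[symmetric]) (use card_le assms finite_chains in auto)
  also have "\<dots> = (\<Sum>n\<le>card A. (-1) ^ n * int (card {c\<in>chains A. card c = n}))"
    by (intro sum.cong) auto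
  also have "\<dots> = int (card {c\<in>chains A. card c = 0})
      + (\<Sum>k<card A. (-1) ^ Suc k * int (card {c\<in>chains A. card c = Suc k}))"
    by (subst sum.atMost_shift) simp
  \<comment> \<open>Finiteness of A matters, since \<open>card\<close> is also 0 on infinite
    sets.\<close>
  also have "{c\<in>chains A. card c = 0} = {{}}"
    using assms by (auto simp: chains_def chain_subset_def dest: finite_subset)
  finally show ?thesis
    by (simp add: euler_characteristic_def num_complete_subgraphs_barycentric_graph assms
        sum_negf) (simp add: barycentric_graph_def)
qed

lemma euler_characteristic_unit_sphere:
  assumes G: "simplicial_complex G" and x: "x \<in> G"
  shows "1 - euler_characteristic (unit_sphere (barycentric_graph G) x)
    = (\<Sum>w | w \<in> G \<and> x \<subseteq> w. (-1) ^ Suc (card w))"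
proof -
  have finG: "finite G" and fin: "\<And>y. y \<in> G \<Longrightarrow> finite y" and ne: "{} \<notin> G"
    and sub: "\<And>y z. y \<in> G \<Longrightarrow> z \<subseteq> y \<Longrightarrow> z \<noteq> {} \<Longrightarrow> z \<in> G"
    using G unfolding simplicial_complex_def by blast+
  let ?below = "{y\<in>G. y \<subset> x}" and ?above = "{y\<in>G. x \<subset> y}"
  have below: "chain_sum ?below = - ((-1) ^ card x)"
  proof -
    have "?below = {y. {} \<subset> y \<and> y \<subset> x}" using sub[OF x] ne by auto
    moreover have "{} \<subset> x" using x ne by auto
    ultimately show ?thesis using chain_sum_open_interval[OF fin[OF x], of "{}"] by simp
  qed
  \<comment> \<open>The part above x is in general no Boolean interval, but what lies in it strictly
    below a member m is an open one.\<close>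
  have "chain_sum ?above = 1 - (\<Sum>m\<in>?above. chain_sum {y\<in>?above. y \<subset> m})"
    by (rule chain_sum_by_maximum) (simp add: finG)
  also have "(\<Sum>m\<in>?above. chain_sum {y\<in>?above. y \<subset> m})
      = (\<Sum>m\<in>?above. - ((-1) ^ card x * (-1) ^ card m))"
  proof (rule sum.cong[OF refl])
    fix m assume m: "m \<in> ?above"
    then have "{y\<in>?above. y \<subset> m} = {y. x \<subset> y \<and> y \<subset> m}" using sub[of m] by auto
    then show "chain_sum {y\<in>?above. y \<subset> m} = - ((-1) ^ card x * (-1) ^ card m)"
      using chain_sum_open_interval[of m x] m fin by simp
  qed
  finally have above: "chain_sum ?above = 1 + (-1) ^ card x * (\<Sum>m\<in>?above. (-1) ^ card m)"
    by (simp add: sum_negf sum_distrib_left)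
  have "1 - euler_characteristic (unit_sphere (barycentric_graph G) x)
      = chain_sum {y\<in>G. y \<subset> x \<or> x \<subset> y}"
    by (simp add: unit_sphere_barycentric_graph[OF x] euler_characteristic_barycentric_graph finG)
  also have "{y\<in>G. y \<subset> x \<or> x \<subset> y} = ?below \<union> ?above" by auto
  also have "chain_sum \<dots> = chain_sum ?below * chain_sum ?above"
    by (rule chain_sum_union) (auto simp: finG)
  also have "\<dots> = - ((-1) ^ card x) - (\<Sum>m\<in>?above. (-1) ^ card m)"
    unfolding below above by (simp add: algebra_simps flip: power_add)
  \<comment> \<open>The isolated term is the contribution of x to its own star.\<close>
  also have "\<dots> = (\<Sum>w\<in>insert x ?above. (-1) ^ Suc (card w))"
    by (simp add: finG sum_negf)
  also have "insert x ?above = {w. w \<in> G \<and> x \<subseteq> w}" using x by auto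
  finally show ?thesis .
qed

section \<open>The inverse of the connection matrix\<close>

text \<open>The candidate inverse. The prefactor is s(x) s(y), whose two extra minus signs
  cancel.\<close>

definition green_function :: "'a set set \<Rightarrow> 'a set \<Rightarrow> 'a set \<Rightarrow> int" where
  "green_function G x y =
     (-1) ^ card x * (-1) ^ card y * (\<Sum>w | w \<in> G \<and> x \<subseteq> w \<and> y \<subseteq> w. (-1) ^ Suc (card w))"

lemma green_function_commute: "green_function G x y = green_function G y x"
  by (simp add: green_function_def conj_commute mult.commute)

lemma green_function_diag:
  "green_function G x x = (\<Sum>w | w \<in> G \<and> x \<subseteq> w. (-1) ^ Suc (card w))"
  by (simp add: green_function_def flip: power_add)

text \<open>The non-empty subsets of w that miss x are those of \<open>w - x\<close>. Removing them
  from all non-empty subsets of w leaves 1 - 1, or 1 - 0 when \<open>w - x\<close> is empty.\<close>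

lemma sum_alternating_meeting_subsets:
  assumes "finite w" and "w \<noteq> {}"
  shows "(\<Sum>y | y \<subseteq> w \<and> x \<inter> y \<noteq> {}. (-1) ^ Suc (card y)) = (if w \<subseteq> x then 1 else (0::int))"
proof -
  let ?f = "\<lambda>y. (-1) ^ Suc (card y) :: int"
  have "{y. y \<noteq> {} \<and> y \<subseteq> w} = {y. y \<subseteq> w \<and> x \<inter> y \<noteq> {}} \<union> {y. y \<noteq> {} \<and> y \<subseteq> w - x}" by auto
  moreover have "sum ?f ({y. y \<subseteq> w \<and> x \<inter> y \<noteq> {}} \<union> {y. y \<noteq> {} \<and> y \<subseteq> w - x})
      = sum ?f {y. y \<subseteq> w \<and> x \<inter> y \<noteq> {}} + sum ?f {y. y \<noteq> {} \<and> y \<subseteq> w - x}"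
    by (rule sum.union_disjoint) (auto intro: finite_subset[of _ "Pow w"] simp: assms)
  ultimately show ?thesis
    using sum_alternating_nonempty_subsets[OF assms(1)]
      sum_alternating_nonempty_subsets[of "w - x"] assms
    by (auto split: if_splits)
qed

text \<open>After exchanging the sums, the sum over y for a fixed w survives only if w lies in x.
  What remains is an alternating sum over the interval from z to x, which is a Kronecker
  delta.\<close>

lemma connection_times_green_function:
  assumes G: "simplicial_complex G" and x: "x \<in> G" and z: "z \<in> G"
  shows "(\<Sum>y\<in>G. (if x \<inter> y \<noteq> {} then 1 else 0) * green_function G y z) = (if x = z then 1 else 0)"
proof -
  have finG: "finite G" and fin: "\<And>y. y \<in> G \<Longrightarrow> finite y" and ne: "{} \<notin> G"
    and sub: "\<And>y u. y \<in> G \<Longrightarrow> u \<subseteq> y \<Longrightarrow> u \<noteq> {} \<Longrightarrow> u \<in> G"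
    using G unfolding simplicial_complex_def by blast+
  let ?s = "\<lambda>y. (-1) ^ card y :: int"
  \<comment> \<open>The minus sign is moved from w to y, to match
    \<open>sum_alternating_meeting_subsets\<close>.\<close>
  let ?g = "\<lambda>y. \<Sum>w | w \<in> G \<and> z \<subseteq> w \<and> y \<subseteq> w. ?s z * ?s w * - ?s y"
  have "green_function G y z = ?g y" for y
    by (simp add: green_function_commute[of G y] green_function_def sum_distrib_left ac_simps)
  then have "(\<Sum>y\<in>G. (if x \<inter> y \<noteq> {} then 1 else 0) * green_function G y z)
      = (\<Sum>y\<in>G. if x \<inter> y \<noteq> {} then ?g y else 0)"
    by (intro sum.cong) simp_all
  also have "\<dots> = (\<Sum>y | y \<in> G \<and> x \<inter> y \<noteq> {}. ?g y)"
    by (rule sum.inter_filter[OF finG, symmetric])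
  also have "\<dots> = (\<Sum>y | y \<in> G \<and> x \<inter> y \<noteq> {}. \<Sum>w\<in>{w\<in>G. z \<subseteq> w}.
      if y \<subseteq> w then ?s z * ?s w * - ?s y else 0)"
    by (simp add: finG conj_assoc flip: sum.inter_filter)
  also have "\<dots> = (\<Sum>w\<in>{w\<in>G. z \<subseteq> w}. \<Sum>y | y \<in> G \<and> x \<inter> y \<noteq> {}.
      if y \<subseteq> w then ?s z * ?s w * - ?s y else 0)"
    by (rule sum.swap)
  also have "\<dots> = (\<Sum>w\<in>{w\<in>G. z \<subseteq> w}. ?s z * (if w \<subseteq> x then ?s w else 0))"
  proof (rule sum.cong[OF refl])
    fix w assume w: "w \<in> {w\<in>G. z \<subseteq> w}"
    \<comment> \<open>A subset of w that meets x is non-empty, hence a simplex.\<close>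
    have "{y\<in>{y. y \<in> G \<and> x \<inter> y \<noteq> {}}. y \<subseteq> w} = {y. y \<subseteq> w \<and> x \<inter> y \<noteq> {}}"
      using w sub by auto
    then have "(\<Sum>y | y \<in> G \<and> x \<inter> y \<noteq> {}. if y \<subseteq> w then ?s z * ?s w * - ?s y else 0)
        = (\<Sum>y | y \<subseteq> w \<and> x \<inter> y \<noteq> {}. ?s z * ?s w * (-1) ^ Suc (card y))"
      by (subst sum.inter_filter[symmetric]) (simp_all add: finG)
    also have "\<dots> = ?s z * ?s w * (\<Sum>y | y \<subseteq> w \<and> x \<inter> y \<noteq> {}. (-1) ^ Suc (card y))"
      by (simp only: sum_distrib_left)
    also have "\<dots> = ?s z * (if w \<subseteq> x then ?s w else 0)"
    proof -
      have "finite w" "w \<noteq> {}" using w fin ne by auto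
      then show ?thesis by (subst sum_alternating_meeting_subsets) simp_all
    qed
    finally show "(\<Sum>y | y \<in> G \<and> x \<inter> y \<noteq> {}. if y \<subseteq> w then ?s z * ?s w * - ?s y else 0)
        = ?s z * (if w \<subseteq> x then ?s w else 0)" .
  qed
  also have "\<dots> = ?s z * (\<Sum>w\<in>{w\<in>{w\<in>G. z \<subseteq> w}. w \<subseteq> x}. ?s w)"
    by (subst sum.inter_filter) (simp_all add: finG sum_distrib_left)
  also have "{w\<in>{w\<in>G. z \<subseteq> w}. w \<subseteq> x} = {w. z \<subseteq> w \<and> w \<subseteq> x}"
    using sub[OF x] z ne by (cases "z = {}") auto
  also have "?s z * sum ?s {w. z \<subseteq> w \<and> w \<subseteq> x} = (if x = z then 1 else 0)"
  proof (cases "z \<subseteq> x")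
    case True
    then show ?thesis
      using sum_alternating_interval[OF fin[OF x] True] by (simp flip: power_add)
  next
    case False
    then have empty: "{w. z \<subseteq> w \<and> w \<subseteq> x} = {}" and "x \<noteq> z" by auto
    then show ?thesis unfolding empty by simp
  qed
  finally show ?thesis .
qed

theorem mainTheorem1:
  fixes G :: "'a set set" and xs :: "'a set list"
  assumes "simplicial_complex G"
    and "distinct xs" and "set xs = G"
  shows "let M = 1\<^sub>m (length xs) + adjacency_matrix (connection_graph G) xs in
    invertible_mat M \<and>
    (\<forall>B. inverts_mat M B \<and> inverts_mat B M \<longrightarrow>
      (\<forall>i<length xs. B $$ (i, i) =
         1 - euler_characteristic (unit_sphere (barycentric_graph G) (xs ! i))))"
proof -
  let ?n = "length xs"
  define M where "M = 1\<^sub>m ?n + adjacency_matrix (connection_graph G) xs"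
  define N where "N = mat ?n ?n (\<lambda>(i, j). green_function G (xs ! i) (xs ! j))"
  have mem: "xs ! i \<in> G" if "i < ?n" for i using that assms(3) by auto
  have ne: "xs ! i \<noteq> {}" if "i < ?n" for i
    using mem[OF that] assms(1) by (auto simp: simplicial_complex_def)
  have M: "M \<in> carrier_mat ?n ?n" by (simp add: M_def adjacency_matrix_def)
  have N: "N \<in> carrier_mat ?n ?n" by (simp add: N_def)
  \<comment> \<open>The identity matrix fills the diagonal, where a non-empty simplex meets
    itself.\<close>
  have M_entry: "M $$ (i, j) = (if xs ! i \<inter> xs ! j \<noteq> {} then 1 else 0)" if "i < ?n" "j < ?n" for i j
    using that mem[of i] mem[of j] ne[of i] assms(2)
    by (auto simp: M_def adjacency_matrix_def connection_graph_def nth_eq_iff_index_eq)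
  have MN: "M * N = 1\<^sub>m ?n"
  proof (rule eq_matI)
    fix i j assume "i < dim_row (1\<^sub>m ?n)" "j < dim_col (1\<^sub>m ?n)"
    then have ij: "i < ?n" "j < ?n" by auto
    have "(M * N) $$ (i, j) = (\<Sum>k<?n. M $$ (i, k) * N $$ (k, j))"
      using ij M N by (simp add: scalar_prod_def atLeast0LessThan)
    also have "\<dots> = (\<Sum>k<?n. (if xs ! i \<inter> xs ! k \<noteq> {} then 1 else 0)
        * green_function G (xs ! k) (xs ! j))"
      by (rule sum.cong) (use ij in \<open>auto simp: M_entry N_def\<close>)
    also have "\<dots> = (\<Sum>y\<in>G. (if xs ! i \<inter> y \<noteq> {} then 1 else 0) * green_function G y (xs ! j))"
      by (rule sum.reindex_bij_betw) (rule bij_betw_nth[OF assms(2)], simp_all add: assms(3))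
    also have "\<dots> = (if xs ! i = xs ! j then 1 else 0)"
      by (rule connection_times_green_function) (use assms(1) mem ij in auto)
    finally show "(M * N) $$ (i, j) = 1\<^sub>m ?n $$ (i, j)"
      using ij assms(2) by (simp add: nth_eq_iff_index_eq)
  qed (use M N in auto)
  have sym: "M\<^sup>T = M" "N\<^sup>T = N"
    by (rule eq_matI; use M N in \<open>auto simp: M_entry N_def Int_commute green_function_commute\<close>)+
  \<comment> \<open>Both matrices are symmetric, so transposing turns a right inverse into a left
    one.\<close>
  have NM: "N * M = 1\<^sub>m ?n"
    using arg_cong[OF MN, of transpose_mat] transpose_mult[OF M N] sym by simp
  have "invertible_mat M"
    using M N MN NM by (auto simp: invertible_mat_def inverts_mat_def)
  moreover have "B $$ (i, i) = 1 - euler_characteristic (unit_sphere (barycentric_graph G) (xs ! i))"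
    if B: "inverts_mat M B" "inverts_mat B M" and i: "i < ?n" for B i
  proof -
    \<comment> \<open>\<open>inverts_mat\<close> does not fix the shape of B; each of the two
      products determines one of its dimensions.\<close>
    have "dim_col B = ?n"
      using B(1) M by (metis inverts_mat_def carrier_matD(1) index_mult_mat(3) index_one_mat(3))
    moreover have "dim_row B = ?n"
      using B(2) M by (metis inverts_mat_def carrier_matD(2) index_mult_mat(3) index_one_mat(3))
    ultimately have Bc: "B \<in> carrier_mat ?n ?n" by auto
    then have "B = B * (M * N)" by (simp add: MN)
    also have "\<dots> = (B * M) * N" by (rule assoc_mult_mat[OF Bc M N, symmetric])
    also have "\<dots> = N" using B(2) Bc N by (simp add: inverts_mat_def)
    finally show ?thesis
      using i euler_characteristic_unit_sphere[OF assms(1) mem[OF i]]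
      by (simp add: N_def green_function_diag)
  qed
  ultimately show ?thesis by (simp add: M_def Let_def)
qed

end
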